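(* Let $f:\mathbb{R}^n\to\mathbb{R}$ be locally Lipschitz and continuously differentiable on an open set $D$ of full measure in $\mathbb{R}^n$. Let $\mathbf{x}\in\mathbb{R}^n$ be a point at which $f$ is differentiable, $m\in\mathbb{N}$, $\varepsilon>0$, and let $G^m_\varepsilon(\mathbf{x})$ be a gradient bundle of $f$ at $\mathbf{x}$, with associated vectors $\mathbf{g}^{I}_\varepsilon$ and $\mathbf{g}^{s}_\varepsilon$. Then: 1. $\lVert \mathbf{g}^{I}_\varepsilon\rVert\le\lVert \mathbf{g}^{s}_\varepsilon\rVert$. 2. If $\mathbf{0}\in G^m_\varepsilon(\mathbf{x})$, then $\mathbf{g}^{I}_\varepsilon=\mathbf{0}$.
   Context: $\lVert\cdot\rVert$ is the Euclidean norm, $B(\mathbf{x},\varepsilon)$ is the closed Euclidean ball centered at $\mathbf{x}$ with radius $\varepsilon$, and $\mathrm{co}$ denotes convex hull. Gradient bundle: given a differentiability point $\mathbf{x}$ of $f$, $\varepsilon>0$ and $m\in\mathbb{N}$, put $\mathbf{s}_0:=\mathbf{x}$ and let $\mathbf{s}_1,\dots,\mathbf{s}_m\in B(\mathbf{x},\varepsilon)$ be sampled points (of the form $\mathbf{x}+\varepsilon\mathbf{u}_j$ with $\mathbf{u}_j$ in the closed unit ball) at which $f$ is differentiable. Then $G^m_\varepsilon(\mathbf{x}):=\mathrm{co}\{\nabla f(\mathbf{s}_0),\dots,\nabla f(\mathbf{s}_m)\}$. $\mathbf{g}^{s}_\varepsilon$ denotes the element of minimum Euclidean norm of $G^m_\varepsilon(\mathbf{x})$.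 For $i=1,\dots,n$ let $G^m_{\varepsilon,i}(\mathbf{x}):=\mathrm{co}\{\frac{\partial f}{\partial x_i}(\mathbf{s}_j): j=0,\dots,m\}\subset\mathbb{R}$. The vector $\mathbf{g}^{I}_\varepsilon=(g^{I}_{\varepsilon,1},\dots,g^{I}_{\varepsilon,n})\in\mathbb{R}^n$ is defined by $g^{I}_{\varepsilon,i}:=\operatorname{argmin}\{|g| : g\in G^m_{\varepsilon,i}(\mathbf{x})\}$. *)

theory Defs
  imports "HOL-Analysis.Analysis"
begin

definition locally_Lipschitz :: "(real ^ 'n \<Rightarrow> real) \<Rightarrow> bool"
  where "locally_Lipschitz f \<longleftrightarrow> (\<forall>x. \<exists>r>0. \<exists>L. L-lipschitz_on (ball x r) f)"

(* Unspecified unless f is (Frechet) differentiable at x. *)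
definition grad :: "(real ^ 'n \<Rightarrow> real) \<Rightarrow> real ^ 'n \<Rightarrow> real ^ 'n"
  where "grad f x = (THE D. GDERIV f x :> D)"

definition partial_deriv :: "(real ^ 'n \<Rightarrow> real) \<Rightarrow> 'n \<Rightarrow> real ^ 'n \<Rightarrow> real"
  where "partial_deriv f i x = deriv (\<lambda>t. f (x + t *\<^sub>R axis i 1)) 0"

definition continuously_differentiable_on ::
    "(real ^ 'n \<Rightarrow> real) \<Rightarrow> (real ^ 'n) set \<Rightarrow> bool"
  where "continuously_differentiable_on f D \<longleftrightarrow>
    (\<forall>y\<in>D. f differentiable (at y)) \<and> continuous_on D (grad f)"

(* The points s 1, ..., s m are the sampled ones; values of s beyond index m are irrelevant. *)
definition gradient_sample ::
    "(real ^ 'n \<Rightarrow> real) \<Rightarrow> real ^ 'n \<Rightarrow> real \<Rightarrow> nat \<Rightarrow> (nat \<Rightarrow> real ^ 'n) \<Rightarrow> bool"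
  where "gradient_sample f x \<epsilon> m s \<longleftrightarrow>
    s 0 = x \<and> (\<forall>j\<in>{1..m}. s j \<in> cball x \<epsilon> \<and> f differentiable (at (s j)))"

definition gradient_bundle ::
    "(real ^ 'n \<Rightarrow> real) \<Rightarrow> nat \<Rightarrow> (nat \<Rightarrow> real ^ 'n) \<Rightarrow> (real ^ 'n) set"
  where "gradient_bundle f m s = convex hull ((\<lambda>j. grad f (s j)) ` {0..m})"

definition partial_bundle ::
    "(real ^ 'n \<Rightarrow> real) \<Rightarrow> nat \<Rightarrow> (nat \<Rightarrow> real ^ 'n) \<Rightarrow> 'n \<Rightarrow> real set"
  where "partial_bundle f m s i = convex hull ((\<lambda>j. partial_deriv f i (s j)) ` {0..m})"

(* The minimisers below exist and are unique, the sets being nonempty, compact and convex. *)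

definition min_norm_gradient ::
    "(real ^ 'n \<Rightarrow> real) \<Rightarrow> nat \<Rightarrow> (nat \<Rightarrow> real ^ 'n) \<Rightarrow> real ^ 'n"
  where "min_norm_gradient f m s = (ARG_MIN norm g. g \<in> gradient_bundle f m s)"

definition componentwise_min_gradient ::
    "(real ^ 'n \<Rightarrow> real) \<Rightarrow> nat \<Rightarrow> (nat \<Rightarrow> real ^ 'n) \<Rightarrow> real ^ 'n"
  where "componentwise_min_gradient f m s =
    (\<chi> i. ARG_MIN abs g. g \<in> partial_bundle f m s i)"

end

theory Submission
  imports Defs
begin

text \<open>
  At a differentiability point the components of the gradient are the partial derivatives, so each
  coordinate projection maps the gradient bundle onto the corresponding bundle of partial
  derivatives. The components of the shortest gradient therefore compete in the coordinatewise
  minimisations.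
\<close>

text \<open>\<open>ARG_MIN\<close> is a Hilbert choice, meaningful only once some minimiser exists;
  the extreme value theorem provides one. Used with \<open>norm\<close> on vectors and with
  \<open>abs\<close> on reals.\<close>

lemma arg_min_compact:
  fixes h :: "'a::topological_space \<Rightarrow> 'b::linorder_topology"
  assumes "compact S" and "S \<noteq> {}" and "continuous_on S h"
  shows arg_min_compact_in: "(ARG_MIN h x. x \<in> S) \<in> S"
    and arg_min_compact_le: "\<And>y. y \<in> S \<Longrightarrow> h (ARG_MIN h x. x \<in> S) \<le> h y"
proof -
  obtain z where "z \<in> S" and "\<forall>y\<in>S. h z \<le> h y"
    using continuous_attains_inf[OF assms] by blast
  then have "is_arg_min h (\<lambda>x. x \<in> S) z"
    by (auto simp: is_arg_min_linorder)
  then have "is_arg_min h (\<lambda>x. x \<in> S) (ARG_MIN h x. x \<in> S)"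
    unfolding arg_min_def by (rule someI)
  then show "(ARG_MIN h x. x \<in> S) \<in> S"
    and "\<And>y. y \<in> S \<Longrightarrow> h (ARG_MIN h x. x \<in> S) \<le> h y"
    by (auto simp: is_arg_min_linorder)
qed

text \<open>Frechet derivatives are unique and a vector is determined by its inner products, so the
  \<open>THE\<close> in \<open>grad\<close> is well defined.\<close>

lemma grad_eqI:
  fixes f :: "real ^ 'n \<Rightarrow> real"
  assumes "GDERIV f y :> D"
  shows "grad f y = D"
  unfolding grad_def
proof (rule the_equality[where P = "\<lambda>D. GDERIV f y :> D", OF assms])
  fix E
  assume "GDERIV f y :> E"
  then have "(\<lambda>h. inner h E) = (\<lambda>h. inner h D)"
    using assms unfolding gderiv_def by (rule has_derivative_unique)
  then show "E = D"
    by (metis vector_eq_ldot)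
qed

lemma has_gderiv_grad:
  fixes f :: "real ^ 'n \<Rightarrow> real"
  assumes "f differentiable (at y)"
  shows "GDERIV f y :> grad f y"
proof -
  obtain f' where f': "(f has_derivative f') (at y)"
    using assms unfolding differentiable_def by blast
  \<comment> \<open>Riesz representation: the adjoint of the functional \<open>f'\<close>, a linear
    map from the reals, sends 1 to the vector representing \<open>f'\<close>.\<close>
  have "inner h (adjoint f' 1) = f' h" for h
    using adjoint_works[OF has_derivative_linear[OF f'], of h 1] by simp
  then have "GDERIV f y :> adjoint f' 1"
    using f' unfolding gderiv_def by simp
  then show ?thesis
    by (simp add: grad_eqI)
qed

text \<open>Chain rule along the line through \<open>y\<close> in direction
  \<open>axis i 1\<close>.\<close>

lemma partial_deriv_eq_grad:
  fixes f :: "real ^ 'n \<Rightarrow> real"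
  assumes "f differentiable (at y)"
  shows "partial_deriv f i y = grad f y $ i"
proof -
  \<comment> \<open>The base point is written as the value of that line at parameter 0, to fit the
    chain rule.\<close>
  have "(f has_derivative (\<lambda>h. inner h (grad f y))) (at (y + 0 *\<^sub>R axis i 1))"
    using has_gderiv_grad[OF assms] by (simp add: gderiv_def)
  moreover have "((\<lambda>t. y + t *\<^sub>R axis i 1) has_derivative (\<lambda>t. t *\<^sub>R axis i 1)) (at 0)"
    by (auto intro!: derivative_eq_intros)
  ultimately have "((\<lambda>t. f (y + t *\<^sub>R axis i 1)) has_derivative
      (\<lambda>t. inner (t *\<^sub>R axis i 1) (grad f y))) (at 0)"
    by (rule has_derivative_compose[rotated])
  then have "((\<lambda>t. f (y + t *\<^sub>R axis i 1)) has_real_derivative grad f y $ i) (at 0)"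
    by (rule has_derivative_imp_has_field_derivative) (simp add: inner_axis' mult.commute)
  then show ?thesis
    unfolding partial_deriv_def by (rule DERIV_imp_deriv)
qed

text \<open>Linear maps commute with convex hulls; here the map is the projection to coordinate
  \<open>i\<close>.\<close>

lemma partial_bundle_eq_image:
  fixes f :: "real ^ 'n \<Rightarrow> real"
  assumes "\<And>j. j \<le> m \<Longrightarrow> f differentiable (at (s j))"
  shows "partial_bundle f m s i = (\<lambda>g. g $ i) ` gradient_bundle f m s"
proof -
  have "linear (\<lambda>g :: real ^ 'n. g $ i)"
    by (simp add: linear_iff)
  moreover have "(\<lambda>j. partial_deriv f i (s j)) ` {0..m} = (\<lambda>j. grad f (s j) $ i) ` {0..m}"
    using assms by (intro image_cong) (auto simp: partial_deriv_eq_grad)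
  ultimately show ?thesis
    unfolding partial_bundle_def gradient_bundle_def
    by (simp add: convex_hull_linear_image image_image)
qed

lemma
  shows compact_gradient_bundle: "compact (gradient_bundle f m s)"
    and gradient_bundle_nonempty: "gradient_bundle f m s \<noteq> {}"
  unfolding gradient_bundle_def by (auto intro: finite_imp_compact_convex_hull)

lemma compact_partial_bundle: "compact (partial_bundle f m s i)"
  unfolding partial_bundle_def by (auto intro: finite_imp_compact_convex_hull)

text \<open>Stated for every \<open>g\<close> in the bundle: the shortest element gives the norm
  inequality, and \<open>g = 0\<close> gives the vanishing claim.\<close>

lemma componentwise_min_gradient_le:
  fixes f :: "real ^ 'n \<Rightarrow> real"
  assumes "\<And>j. j \<le> m \<Longrightarrow> f differentiable (at (s j))"
    and "g \<in> gradient_bundle f m s"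
  shows "\<bar>componentwise_min_gradient f m s $ i\<bar> \<le> \<bar>g $ i\<bar>"
proof -
  have "g $ i \<in> partial_bundle f m s i"
    using assms by (simp add: partial_bundle_eq_image)
  moreover from this have "partial_bundle f m s i \<noteq> {}"
    by blast
  ultimately show ?thesis
    unfolding componentwise_min_gradient_def
    by (auto intro!: arg_min_compact_le[where h = abs] compact_partial_bundle continuous_intros)
qed

theorem lemma4p1:
  fixes f :: "real ^ 'n \<Rightarrow> real"
    and D :: "(real ^ 'n) set"
    and x :: "real ^ 'n"
    and m :: nat
    and \<epsilon> :: real
    and s :: "nat \<Rightarrow> real ^ 'n"
  assumes "locally_Lipschitz f"
    and "open D"
    and "negligible (- D)"
    and "continuously_differentiable_on f D"
    and "f differentiable (at x)"
    and "\<epsilon> > 0"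
    and "gradient_sample f x \<epsilon> m s"
  shows "norm (componentwise_min_gradient f m s) \<le> norm (min_norm_gradient f m s)
    \<and> (0 \<in> gradient_bundle f m s \<longrightarrow> componentwise_min_gradient f m s = 0)"
proof -
  \<comment> \<open>Index 0 is the point \<open>x\<close> itself, which has its own
    differentiability hypothesis; the sample condition covers indices from 1 on.\<close>
  have diff: "f differentiable (at (s j))" if "j \<le> m" for j
    using assms(5,7) that unfolding gradient_sample_def by (cases "j = 0") auto
  have "min_norm_gradient f m s \<in> gradient_bundle f m s"
    unfolding min_norm_gradient_def
    by (intro arg_min_compact_in compact_gradient_bundle gradient_bundle_nonempty continuous_intros)
  then have "norm (componentwise_min_gradient f m s) \<le> norm (min_norm_gradient f m s)"
    \<comment> \<open>The Euclidean norm is monotone in the absolute values of the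
      components.\<close>
    by (intro norm_le_componentwise_cart) (simp add: componentwise_min_gradient_le diff)
  moreover have "componentwise_min_gradient f m s = 0" if "0 \<in> gradient_bundle f m s"
    using componentwise_min_gradient_le[OF diff that] by (simp add: vec_eq_iff)
  ultimately show ?thesis
    by blast
qed

end
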